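(* Let $H\in\mathbb{R}^{n\times n}$ be symmetric, $g\in\mathbb{R}^n$ with $g\ne 0$, $M>0$, and let $$m(s)=\langle g,s\rangle+\tfrac12\langle Hs,s\rangle+\tfrac{M}{6}\|s\|^3,\qquad s\in\mathbb{R}^n .$$ Let $Q_L\in\mathbb{R}^{n\times(L+1)}$ have orthonormal columns spanning the Krylov subspace $\mathcal{K}_L(H,g)=\mathrm{span}\{g,Hg,\dots,H^Lg\}$, with $Q_L^\top g=\|g\|e_1$ and $Q_L^\top HQ_L=T_L$ tridiagonal. Then for every $y\in\mathbb{R}^{L+1}$, $$m(Q_Ly)=\hat m(y):=\|g\|\,e_1^\top y+\tfrac12\,y^\top T_L\,y+\tfrac{M}{6}\|y\|^3 .$$ Consequently, if $y^\star$ is a minimizer of $\hat m$ over $\mathbb{R}^{L+1}$, then $s_L:=Q_Ly^\star$ is an exact minimizer of $m$ over $\mathcal{K}_L(H,g)$: $$m(s_L)=\min_{s\in\mathcal{K}_L(H,g)}m(s).$$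
   Context: $e_1$ is the first standard basis vector of $\mathbb{R}^{L+1}$; $\|\cdot\|$ is the Euclidean norm. The matrices $Q_L$, $T_L$ are those produced by $L+1$ steps of the Lanczos process on $(H,g)$ (assumed not to break down, so that $\mathcal{K}_L(H,g)$ has dimension $L+1$). *)

theory Defs
  imports "HOL-Analysis.Analysis"
begin

definition cubic_model :: "real^'n^'n \<Rightarrow> real^'n \<Rightarrow> real \<Rightarrow> real^'n \<Rightarrow> real" where
  "cubic_model H g M s = g \<bullet> s + 1 / 2 * ((H *v s) \<bullet> s) + M / 6 * norm s ^ 3"

definition krylov :: "real^'n^'n \<Rightarrow> real^'n \<Rightarrow> nat \<Rightarrow> (real^'n) set" where
  "krylov H g L = span ((\<lambda>k. ((*v) H ^^ k) g) ` {..L})"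

definition orthonormal_columns :: "real^'l^'n \<Rightarrow> bool" where
  "orthonormal_columns Q \<longleftrightarrow>
     (\<forall>i. norm (column i Q) = 1) \<and> (\<forall>i j. i \<noteq> j \<longrightarrow> column i Q \<bullet> column j Q = 0)"

text \<open>The coordinates of \<open>\<real>\<^sup>L\<^sup>+\<^sup>1\<close> are indexed by a finite linearly ordered type with
  \<open>L + 1\<close> elements: its least element is the first coordinate, and \<open>pos i\<close> is the number of
  coordinates preceding \<open>i\<close>, so that \<open>pos\<close> is the order isomorphism onto \<open>{0..L}\<close>.\<close>

definition pos :: "'l::{finite,linorder} \<Rightarrow> nat" where
  "pos i = card {..<i}"

definition e1 :: "real^'l::{finite,linorder}" where
  "e1 = axis (Min UNIV) 1"

definition tridiagonal :: "real^'l::{finite,linorder}^'l::{finite,linorder} \<Rightarrow> bool" where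
  "tridiagonal T \<longleftrightarrow> (\<forall>i j. pos i + 1 < pos j \<or> pos j + 1 < pos i \<longrightarrow> T $ i $ j = 0)"

definition reduced_model ::
    "real^'n \<Rightarrow> real^'l::{finite,linorder}^'l::{finite,linorder} \<Rightarrow> real \<Rightarrow> real^'l::{finite,linorder} \<Rightarrow> real" where
  "reduced_model g T M y = norm g * (e1 \<bullet> y) + 1 / 2 * (y \<bullet> (T *v y)) + M / 6 * norm y ^ 3"

end

theory Submission
  imports Defs
begin

text \<open>Orthonormal columns give \<open>transpose Q ** Q = mat 1\<close>, so the map taking y to
  \<open>Q *v y\<close> is a linear isometry, and its range is the span of the columns, here the
  Krylov subspace. Hence the cubic term keeps its value
  (\<open>norm_orthonormal_columns_mult\<close>), while moving \<open>Q\<close> across the inner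
  product turns the linear and quadratic terms into those of the reduced model
  (\<open>cubic_model_orthonormal_columns_mult\<close>). Since every Krylov vector is some
  \<open>Q *v y\<close> (\<open>span_columns_eq_range\<close>), minimizing over the subspace is the
  same problem as minimizing the reduced model over all y.\<close>

lemma transpose_mult_orthonormal_columns:
  assumes "orthonormal_columns Q"
  shows "transpose Q ** Q = mat 1"
proof -
  have "(transpose Q ** Q) $ i $ j = column i Q \<bullet> column j Q" for i j
    by (simp add: matrix_matrix_mult_def transpose_def column_def inner_vec_def)
  moreover have "column i Q \<bullet> column j Q = (if i = j then 1 else 0)" for i j
    using assms by (simp add: orthonormal_columns_def flip: power2_norm_eq_inner)
  ultimately show ?thesis
    by (simp add: vec_eq_iff mat_def)
qed

lemma inner_matrix_vector_mult:
  fixes A :: "real^'l^'n"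
  shows "x \<bullet> (A *v y) = (transpose A *v x) \<bullet> y"
  by (simp add: dot_lmul_matrix)

lemma norm_orthonormal_columns_mult:
  assumes "orthonormal_columns Q"
  shows "norm (Q *v y) = norm y"
  by (simp add: norm_eq_sqrt_inner inner_matrix_vector_mult matrix_vector_mul_assoc
      transpose_mult_orthonormal_columns[OF assms])

text \<open>Supplies coordinates for each vector of the subspace, so that a minimizer over all
  coordinate vectors competes against the whole subspace. The columns are the images of the standard
  basis vectors.\<close>

lemma span_columns_eq_range:
  fixes A :: "real^'l^'n"
  shows "span (columns A) = range ((*v) A)"
proof
  have "columns A \<subseteq> range ((*v) A)"
    by (auto simp: columns_def simp flip: matrix_vector_mult_basis)
  then show "span (columns A) \<subseteq> range ((*v) A)"
    by (simp add: span_minimal linear_subspace_image)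
  show "range ((*v) A) \<subseteq> span (columns A)"
    by (auto simp: matrix_vector_mult_in_columnspace)
qed

lemma cubic_model_orthonormal_columns_mult:
  fixes H :: "real^'n^'n" and Q :: "real^'l::{finite,linorder}^'n"
  assumes "orthonormal_columns Q"
    and "transpose Q *v g = norm g *\<^sub>R e1"
  shows "cubic_model H g M (Q *v y) = reduced_model g (transpose Q ** H ** Q) M y"
proof -
  have "(H *v (Q *v y)) \<bullet> (Q *v y) = y \<bullet> ((transpose Q ** H ** Q) *v y)"
    \<comment> \<open>The adjoint identity is applied to \<open>transpose Q\<close>, whose own
      transpose is \<open>Q\<close> again.\<close>
    using inner_matrix_vector_mult[of y "transpose Q" "H *v (Q *v y)"]
    by (simp add: matrix_vector_mul_assoc matrix_mul_assoc inner_commute)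
  moreover have "g \<bullet> (Q *v y) = norm g * (e1 \<bullet> y)"
    using assms(2) by (simp add: inner_matrix_vector_mult)
  ultimately show ?thesis
    by (simp add: cubic_model_def reduced_model_def norm_orthonormal_columns_mult[OF assms(1)])
qed

theorem lemma3p5:
  fixes H :: "real^'n^'n" and g :: "real^'n" and M :: real and L :: nat
    and Q :: "real^'l::{finite,linorder}^'n" and T :: "real^'l::{finite,linorder}^'l::{finite,linorder}"
  assumes "transpose H = H"
    and "g \<noteq> 0"
    and "M > 0"
    and "CARD('l::{finite,linorder}) = L + 1"
    and "orthonormal_columns Q"
    and "span (columns Q) = krylov H g L"
    and "transpose Q *v g = norm g *\<^sub>R e1"
    and "transpose Q ** H ** Q = T"
    and "tridiagonal T"
  shows "(\<forall>y. cubic_model H g M (Q *v y) = reduced_model g T M y) \<and>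
    (\<forall>y\<^sub>0. is_arg_min (reduced_model g T M) (\<lambda>_. True) y\<^sub>0 \<longrightarrow>
       is_arg_min (cubic_model H g M) (\<lambda>s. s \<in> krylov H g L) (Q *v y\<^sub>0) \<and>
       cubic_model H g M (Q *v y\<^sub>0) = (INF s\<in>krylov H g L. cubic_model H g M s))"
proof (intro conjI allI impI)
  show reduce: "cubic_model H g M (Q *v y) = reduced_model g T M y" for y
    using cubic_model_orthonormal_columns_mult[OF assms(5,7)] assms(8) by simp
  have krylov: "krylov H g L = range ((*v) Q)"
    using assms(6) span_columns_eq_range by metis
  fix y\<^sub>0
  assume "is_arg_min (reduced_model g T M) (\<lambda>_. True) y\<^sub>0"
  then have min: "cubic_model H g M (Q *v y\<^sub>0) \<le> cubic_model H g M s" if "s \<in> krylov H g L" for s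
    using that by (auto simp: krylov reduce is_arg_min_linorder)
  have mem: "Q *v y\<^sub>0 \<in> krylov H g L"
    by (simp add: krylov)
  show "is_arg_min (cubic_model H g M) (\<lambda>s. s \<in> krylov H g L) (Q *v y\<^sub>0)"
    using min mem by (simp add: is_arg_min_linorder)
  \<comment> \<open>A real \<open>INF\<close> is meaningful only for a nonempty family bounded
    below; the value attained at \<open>Q *v y\<^sub>0\<close> provides both.\<close>
  show "cubic_model H g M (Q *v y\<^sub>0) = (INF s\<in>krylov H g L. cubic_model H g M s)"
    using min mem by (intro cInf_eq_minimum[symmetric]) auto
qed

end
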